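(* Let $\mathcal{G}$ be an undirected, connected, weighted graph with $N$ vertices, and let $k\in\{0,1,\dots,N-1\}$. If for some $\gamma>0$ a kernel $\hat f$ satisfies $$\sqrt N\sum_{\ell=1}^{N-1}\mu_\ell\,|\hat f(\lambda_\ell)|\le\frac{|\hat f(0)|}{1+\gamma},$$ then $$|\widehat{M_k f}(\lambda_k)|\ge\gamma\,|\widehat{M_k f}(\lambda_\ell)|\quad\text{for all }\ell\ne k.$$
   Context: Setting: $\mathcal{G}=\{\mathcal{V},\mathcal{E},W\}$ is a finite undirected, connected, weighted graph with vertices $\{1,\dots,N\}$, where $W$ is a symmetric weighted adjacency matrix (non-negative entries, zero diagonal, $W_{mn}>0$ iff $(m,n)\in\mathcal{E}$). $D$ is the diagonal matrix of degrees $d_n=\sum_{m\ne n}W_{mn}$ and $\mathcal{L}=D-W$ is the graph Laplacian. $\{\chi_\ell\}_{\ell=0,\dots,N-1}$ is a fixed orthonormal basis of eigenvectors of $\mathcal{L}$ (possibly complex-valued) with eigenvalues $0=\lambda_0<\lambda_1\le\dots\le\lambda_{N-1}$, and $\chi_0(n)=1/\sqrt N$ for all $n$. A superscript $*$ on a scalar denotes complex conjugation. The graph Fourier transform of a signal $f$ on the vertices is $\hat f(\lambda_\ell):=\sum_{n=1}^N f(n)\chi_\ell^*(n)$, viewed as a vector indexed by $\ell\in\{0,\dots,N-1\}$ (one entry per $\ell$, also when eigenvalues repeat); $\hat f(0)$ means $\hat f(\lambda_0)$. Its inverse is $f(n)=\sum_{\ell=0}^{N-1}\hat f(\lambda_\ell)\chi_\ell(n)$;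 a kernel $\hat f$ (real values assigned to the eigenvalues) thereby determines the signal $f$. The same formulas are used for complex-valued signals. $\mu_\ell:=\max_{i\in\{1,\dots,N\}}|\chi_\ell(i)|$. The generalized modulation operator is $(M_k f)(n):=\sqrt N f(n)\chi_k(n)$. *)

theory Defs
  imports "HOL-Analysis.Analysis"
begin

text \<open>
  Vertices are the elements of a finite type \<open>'n\<close>, so that \<open>N = CARD('n)\<close>; spectral indices are the
  natural numbers below \<open>CARD('n)\<close>.
\<close>

definition weighted_adjacency :: "real^'n^'n \<Rightarrow> bool" where
  "weighted_adjacency W \<longleftrightarrow>
     (\<forall>m n. W $ m $ n = W $ n $ m) \<and> (\<forall>m n. 0 \<le> W $ m $ n) \<and> (\<forall>n. W $ n $ n = 0)"

definition graph_edges :: "real^'n^'n \<Rightarrow> ('n \<times> 'n) set" where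
  "graph_edges W = {(m, n). W $ m $ n > 0}"

definition connected_weighted_graph :: "real^'n^'n \<Rightarrow> bool" where
  "connected_weighted_graph W \<longleftrightarrow>
     weighted_adjacency W \<and> (\<forall>m n. (m, n) \<in> (graph_edges W)\<^sup>*)"

definition vertex_degree :: "real^'n^'n \<Rightarrow> 'n \<Rightarrow> real" where
  "vertex_degree W n = (\<Sum>m\<in>UNIV - {n}. W $ m $ n)"

definition degree_matrix :: "real^'n^'n \<Rightarrow> real^'n^'n" where
  "degree_matrix W = (\<chi> m n. if m = n then vertex_degree W n else 0)"

definition graph_laplacian :: "real^'n^'n \<Rightarrow> real^'n^'n" where
  "graph_laplacian W = degree_matrix W - W"

text \<open>
  Orthonormality is with respect to the Hermitian inner product (the class operation \<open>inner\<close> on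
  \<open>complex^'n\<close> is only its real part), and the span is over the complex scalars.
\<close>

definition orthonormal_basis :: "(nat \<Rightarrow> complex^'n) \<Rightarrow> bool" where
  "orthonormal_basis chi \<longleftrightarrow>
     (\<forall>i<CARD('n). \<forall>j<CARD('n).
        (\<Sum>n\<in>UNIV. chi i $ n * cnj (chi j $ n)) = (if i = j then 1 else 0)) \<and>
     vec.span (chi ` {..<CARD('n)}) = UNIV"

definition laplacian_eigenbasis ::
    "real^'n^'n \<Rightarrow> (nat \<Rightarrow> complex^'n) \<Rightarrow> (nat \<Rightarrow> real) \<Rightarrow> bool" where
  "laplacian_eigenbasis W chi lam \<longleftrightarrow>
     orthonormal_basis chi \<and>
     (\<forall>l<CARD('n). map_matrix complex_of_real (graph_laplacian W) *v chi l
                     = complex_of_real (lam l) *s chi l) \<and>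
     lam 0 = 0 \<and>
     (\<forall>l. 0 < l \<and> l < CARD('n) \<longrightarrow> 0 < lam l) \<and>
     (\<forall>i j. i \<le> j \<and> j < CARD('n) \<longrightarrow> lam i \<le> lam j) \<and>
     (\<forall>n. chi 0 $ n = complex_of_real (1 / sqrt (real CARD('n))))"

text \<open>
  The graph Fourier transform is indexed by the position \<open>l\<close> in the spectrum rather than by the value
  \<open>lam l\<close>, so repeated eigenvalues contribute one entry each.
\<close>

definition graph_fourier :: "(nat \<Rightarrow> complex^'n) \<Rightarrow> complex^'n \<Rightarrow> nat \<Rightarrow> complex" where
  "graph_fourier chi f l = (\<Sum>n\<in>UNIV. f $ n * cnj (chi l $ n))"

definition inverse_graph_fourier :: "(nat \<Rightarrow> complex^'n) \<Rightarrow> (nat \<Rightarrow> complex) \<Rightarrow> complex^'n" where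
  "inverse_graph_fourier chi fhat = (\<chi> n. \<Sum>l<CARD('n). fhat l * chi l $ n)"

definition eigvec_max :: "(nat \<Rightarrow> complex^'n) \<Rightarrow> nat \<Rightarrow> real" where
  "eigvec_max chi l = Max (range (\<lambda>i. cmod (chi l $ i)))"

definition graph_modulation :: "(nat \<Rightarrow> complex^'n) \<Rightarrow> nat \<Rightarrow> complex^'n \<Rightarrow> complex^'n" where
  "graph_modulation chi k f =
     (\<chi> n. complex_of_real (sqrt (real CARD('n))) * f $ n * chi k $ n)"

end

theory Submission
  imports Defs
begin

text \<open>
  Expanding \<open>f\<close> in the eigenbasis splits the transform of the modulated signal at frequency \<open>l\<close> as
  \<open>fhat 0 * \<delta>\<^sub>k\<^sub>l + sqrt N * (\<Sum>j\<ge>1. fhat j * (\<Sum>n. chi j n * chi k n * cnj (chi l n)))\<close>,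
  because \<open>chi 0\<close> is the constant \<open>1 / sqrt N\<close> and \<open>chi k\<close>, \<open>chi l\<close> are orthonormal: the constant
  mode moves exactly to frequency \<open>k\<close>, and everything else is leakage.
  Since \<open>chi k\<close> and \<open>chi l\<close> are unit vectors, each triple product is at most the maximal modulus
  \<open>\<mu>\<^sub>j\<close> of \<open>chi j\<close> (lemma \<open>triple_product_le_eigvec_max\<close>), so at every frequency the leakage is
  bounded by \<open>sqrt N * (\<Sum>j\<ge>1. \<mu>\<^sub>j * \<bar>fhat j\<bar>)\<close> (lemma \<open>fourier_modulation_leakage\<close>), which by
  hypothesis is at most \<open>\<bar>fhat 0\<bar> / (1 + \<gamma>)\<close>. Frequency \<open>k\<close> therefore retains at least
  \<open>\<bar>fhat 0\<bar> - \<bar>fhat 0\<bar> / (1 + \<gamma>) = \<gamma> * (\<bar>fhat 0\<bar> / (1 + \<gamma>))\<close>, while every other frequency carries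
  at most \<open>\<bar>fhat 0\<bar> / (1 + \<gamma>)\<close>.
\<close>

lemma orthonormal_basis_inner:
  fixes chi :: "nat \<Rightarrow> complex^'n"
  assumes "orthonormal_basis chi" "i < CARD('n)" "j < CARD('n)"
  shows "(\<Sum>n\<in>UNIV. chi i $ n * cnj (chi j $ n)) = (if i = j then 1 else 0)"
  using assms unfolding orthonormal_basis_def by blast

lemma orthonormal_basis_unit:
  fixes chi :: "nat \<Rightarrow> complex^'n"
  assumes "orthonormal_basis chi" "i < CARD('n)"
  shows "(\<Sum>n\<in>UNIV. (cmod (chi i $ n))\<^sup>2) = 1"
proof -
  have "complex_of_real (\<Sum>n\<in>UNIV. (cmod (chi i $ n))\<^sup>2) = 1"
    using orthonormal_basis_inner[OF assms(1,2,2)] by (simp add: complex_norm_square del: of_real_power)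
  then show ?thesis by (simp only: of_real_eq_1_iff)
qed

lemma sum_cmod_mult_le_1:
  fixes chi :: "nat \<Rightarrow> complex^'n"
  assumes "orthonormal_basis chi" "k < CARD('n)" "l < CARD('n)"
  shows "(\<Sum>n\<in>UNIV. cmod (chi k $ n) * cmod (chi l $ n)) \<le> 1"
proof -
  have "(\<Sum>n\<in>UNIV. cmod (chi k $ n) * cmod (chi l $ n))
      \<le> (\<Sum>n\<in>UNIV. ((cmod (chi k $ n))\<^sup>2 + (cmod (chi l $ n))\<^sup>2) / 2)"
  proof (rule sum_mono)
    fix n
    show "cmod (chi k $ n) * cmod (chi l $ n)
        \<le> ((cmod (chi k $ n))\<^sup>2 + (cmod (chi l $ n))\<^sup>2) / 2"
      using sum_squares_bound[of "cmod (chi k $ n)" "cmod (chi l $ n)"] by simp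
  qed
  also have "\<dots> = 1"
    using orthonormal_basis_unit[OF assms(1,2)] orthonormal_basis_unit[OF assms(1,3)]
    by (simp add: sum_divide_distrib[symmetric] sum.distrib)
  finally show ?thesis .
qed

lemma cmod_le_eigvec_max: "cmod (chi j $ n) \<le> eigvec_max chi j"
  unfolding eigvec_max_def by (rule Max_ge) auto

text \<open>
  After absolute values are taken inside the sum, the factor \<open>chi j\<close> is bounded pointwise by its
  maximal modulus, and what remains is at most the product of the norms of the unit vectors
  \<open>chi k\<close> and \<open>chi l\<close>.
\<close>

lemma triple_product_le_eigvec_max:
  fixes chi :: "nat \<Rightarrow> complex^'n"
  assumes "orthonormal_basis chi" "k < CARD('n)" "l < CARD('n)"
  shows "cmod (\<Sum>n\<in>UNIV. chi j $ n * chi k $ n * cnj (chi l $ n)) \<le> eigvec_max chi j"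
proof -
  have "cmod (\<Sum>n\<in>UNIV. chi j $ n * chi k $ n * cnj (chi l $ n))
      \<le> (\<Sum>n\<in>UNIV. cmod (chi j $ n) * (cmod (chi k $ n) * cmod (chi l $ n)))"
    by (rule sum_norm_le) (simp add: norm_mult)
  also have "\<dots> \<le> (\<Sum>n\<in>UNIV. eigvec_max chi j * (cmod (chi k $ n) * cmod (chi l $ n)))"
    by (intro sum_mono mult_right_mono cmod_le_eigvec_max) simp
  also have "\<dots> = eigvec_max chi j * (\<Sum>n\<in>UNIV. cmod (chi k $ n) * cmod (chi l $ n))"
    by (simp add: sum_distrib_left)
  also have "\<dots> \<le> eigvec_max chi j"
    using order_trans[OF norm_ge_zero cmod_le_eigvec_max]
    by (intro mult_left_le sum_cmod_mult_le_1 assms) auto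
  finally show ?thesis .
qed

lemma fourier_modulation_inverse_fourier:
  fixes chi :: "nat \<Rightarrow> complex^'n"
  shows "graph_fourier chi (graph_modulation chi k (inverse_graph_fourier chi g)) l =
    (\<Sum>j<CARD('n). complex_of_real (sqrt (real CARD('n))) * g j *
       (\<Sum>n\<in>UNIV. chi j $ n * chi k $ n * cnj (chi l $ n)))"
proof -
  have "graph_fourier chi (graph_modulation chi k (inverse_graph_fourier chi g)) l =
    (\<Sum>n\<in>UNIV. \<Sum>j<CARD('n). complex_of_real (sqrt (real CARD('n))) * g j *
       (chi j $ n * chi k $ n * cnj (chi l $ n)))"
    by (simp add: graph_fourier_def graph_modulation_def inverse_graph_fourier_def
        sum_distrib_left sum_distrib_right mult_ac)
  also have "\<dots> = (\<Sum>j<CARD('n). \<Sum>n\<in>UNIV. complex_of_real (sqrt (real CARD('n))) * g j *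
       (chi j $ n * chi k $ n * cnj (chi l $ n)))"
    by (rule sum.swap)
  finally show ?thesis by (simp add: sum_distrib_left)
qed

text \<open>
  The factor \<open>sqrt N\<close> in the modulation cancels the constant value of \<open>chi 0\<close>, so by orthonormality
  the mode \<open>j = 0\<close> contributes \<open>g 0\<close> at frequency \<open>k\<close> and nothing elsewhere. The triple products
  of the remaining modes account for the error.
\<close>

lemma fourier_modulation_leakage:
  fixes chi :: "nat \<Rightarrow> complex^'n"
  assumes "orthonormal_basis chi" "k < CARD('n)" "l < CARD('n)"
    and const: "\<And>n. chi 0 $ n = complex_of_real (1 / sqrt (real CARD('n)))"
  shows "cmod (graph_fourier chi (graph_modulation chi k (inverse_graph_fourier chi g)) l
              - (if k = l then g 0 else 0))
       \<le> sqrt (real CARD('n)) * (\<Sum>j\<in>{1..<CARD('n)}. eigvec_max chi j * cmod (g j))"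
proof -
  let ?s = "sqrt (real CARD('n))"
  let ?T = "\<lambda>j. \<Sum>n\<in>UNIV. chi j $ n * chi k $ n * cnj (chi l $ n)"
  have "?T 0 = complex_of_real (1 / ?s) * (\<Sum>n\<in>UNIV. chi k $ n * cnj (chi l $ n))"
    by (simp only: const sum_distrib_left mult.assoc)
  then have T0: "complex_of_real ?s * g 0 * ?T 0 = (if k = l then g 0 else 0)"
    using orthonormal_basis_inner[OF assms(1-3)] by simp
  have "{..<CARD('n)} = insert 0 {1..<CARD('n)}" by auto
  then have "graph_fourier chi (graph_modulation chi k (inverse_graph_fourier chi g)) l
      - (if k = l then g 0 else 0) = (\<Sum>j\<in>{1..<CARD('n)}. complex_of_real ?s * g j * ?T j)"
    using T0 by (simp add: fourier_modulation_inverse_fourier)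
  also have "cmod \<dots> \<le> (\<Sum>j\<in>{1..<CARD('n)}. ?s * (eigvec_max chi j * cmod (g j)))"
  proof (rule sum_norm_le)
    fix j
    have "cmod (?T j) * cmod (g j) \<le> eigvec_max chi j * cmod (g j)"
      by (intro mult_right_mono triple_product_le_eigvec_max assms) simp
    then have "?s * (cmod (?T j) * cmod (g j)) \<le> ?s * (eigvec_max chi j * cmod (g j))"
      by (rule mult_left_mono) simp
    then show "cmod (complex_of_real ?s * g j * ?T j) \<le> ?s * (eigvec_max chi j * cmod (g j))"
      by (simp add: norm_mult mult_ac)
  qed
  finally show ?thesis by (simp add: sum_distrib_left)
qed

theorem theorem2:
  fixes W :: "real^'n^'n"
    and chi :: "nat \<Rightarrow> complex^'n"
    and lam :: "nat \<Rightarrow> real"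
    and fhat :: "nat \<Rightarrow> real"
    and f :: "complex^'n"
    and k :: nat
    and \<gamma> :: real
  assumes "connected_weighted_graph W"
    and "laplacian_eigenbasis W chi lam"
    and "k < CARD('n)"
    and "\<gamma> > 0"
    and "f = inverse_graph_fourier chi (\<lambda>l. complex_of_real (fhat l))"
    and "sqrt (real CARD('n)) * (\<Sum>l\<in>{1..<CARD('n)}. eigvec_max chi l * \<bar>fhat l\<bar>)
           \<le> \<bar>fhat 0\<bar> / (1 + \<gamma>)"
  shows "\<forall>l<CARD('n). l \<noteq> k \<longrightarrow>
           cmod (graph_fourier chi (graph_modulation chi k f) k)
             \<ge> \<gamma> * cmod (graph_fourier chi (graph_modulation chi k f) l)"
proof (intro allI impI)
  fix l assume l: "l < CARD('n)" "l \<noteq> k"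
  let ?F = "graph_fourier chi (graph_modulation chi k f)"
  let ?e = "\<bar>fhat 0\<bar> / (1 + \<gamma>)"
  have basis: "orthonormal_basis chi"
    and const: "\<And>n. chi 0 $ n = complex_of_real (1 / sqrt (real CARD('n)))"
    using assms(2) unfolding laplacian_eigenbasis_def by auto
  have leak: "cmod (?F i - (if k = i then complex_of_real (fhat 0) else 0)) \<le> ?e"
    if "i < CARD('n)" for i
    using fourier_modulation_leakage[OF basis assms(3) that const,
        of "\<lambda>j. complex_of_real (fhat j)"] assms(6)
    unfolding assms(5) by simp
  have "?e * (1 + \<gamma>) = \<bar>fhat 0\<bar>"
    using assms(4) by simp
  then have split: "\<bar>fhat 0\<bar> = ?e + \<gamma> * ?e"
    by (simp only: distrib_left mult_1_right mult.commute[of \<gamma>])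
  have "cmod (?F l) \<le> ?e"
    using leak[OF l(1)] l(2) by simp
  then have "\<gamma> * cmod (?F l) \<le> \<gamma> * ?e"
    using assms(4) by (intro mult_left_mono) auto
  also have "\<dots> = \<bar>fhat 0\<bar> - ?e"
    using split by linarith
  also have "\<dots> \<le> cmod (?F k)"
    using leak[OF assms(3)] norm_triangle_ineq3[of "?F k" "complex_of_real (fhat 0)"] by simp
  finally show "cmod (?F k) \<ge> \<gamma> * cmod (?F l)" .
qed

end
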